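(* Let $n$ and $k$ be positive integers. The equation $(k!)^{n!}+k^n=(n!)^{k!}+n^k$ holds if and only if $k=n$. *)

theory Defs
  imports Complex_Main
begin

end

theory Submission
  imports Defs
begin

text \<open>
  Let \<open>2 \<le> k < n\<close> and write \<open>a = k!\<close>, \<open>n! = m a\<close>. Apart from \<open>(k, n) = (2, 3)\<close> one has
  \<open>m \<ge> 4\<close>, so \<open>a\<^sup>m \<ge> 2 m a\<close>; raising this to the power \<open>a\<close> gives
  \<open>(k!) ^ (n!) \<ge> 2 (n!) ^ (k!) \<ge> (n!) ^ (k!) + n ^ k\<close>.
  Hence the left-hand side exceeds the right-hand side whenever \<open>2 \<le> k < n\<close>.
\<close>

text \<open>For \<open>a = 2\<close>, \<open>m = 4\<close> both sides equal 8. The exponent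
  \<open>m - 1\<close> leaves one factor \<open>a\<close> to match the \<open>a\<close> in
  \<open>2 * m * a\<close>.\<close>

lemma double_le_power_pred:
  fixes a m :: nat
  assumes "2 \<le> a" "4 \<le> m"
  shows "2 * m \<le> a ^ (m - 1)"
proof -
  have "2 * m \<le> 2 ^ (m - 1)"
    using \<open>4 \<le> m\<close>
  proof (induction m rule: dec_induct)
    case (step j)
    then obtain i where "j = Suc i" by (cases j) auto
    with step show ?case by simp
  qed simp
  also have "\<dots> \<le> a ^ (m - 1)"
    using \<open>2 \<le> a\<close> by (rule power_mono) simp
  finally show ?thesis .
qed

lemma double_power_le_power_swap:
  fixes a m :: nat
  assumes "2 \<le> a" "4 \<le> m"
  shows "2 * (m * a) ^ a \<le> a ^ (m * a)"
proof -
  \<comment> \<open>Since \<open>2 \<le> 2 ^ a\<close>, the factor 2 can be moved into the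
    base.\<close>
  have "2 * (m * a) ^ a \<le> 2 ^ a * (m * a) ^ a"
    using assms by (intro mult_right_mono self_le_power) auto
  also have "\<dots> = (2 * m * a) ^ a"
    by (simp add: power_mult_distrib)
  also have "\<dots> \<le> (a ^ (m - 1) * a) ^ a"
    by (intro power_mono mult_right_mono double_le_power_pred assms) auto
  also have "a ^ (m - 1) * a = a ^ m"
    using assms by (cases m) (auto simp: mult.commute)
  also have "(a ^ m) ^ a = a ^ (m * a)"
    by (rule power_mult [symmetric])
  finally show ?thesis .
qed

lemma fact_power_swap_less:
  fixes n k :: nat
  assumes "2 \<le> k" "k < n"
  shows "(fact n :: nat) ^ fact k + n ^ k < fact k ^ fact n + k ^ n"
proof (cases "n = 3")
  \<comment> \<open>Here the quotient n!/k! is only 3, so the values are compared directly: 45 <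
    72.\<close>
  case True
  with assms have "k = 2" by simp
  with True show ?thesis by (simp add: fact_numeral)
next
  case False
  with assms have "4 \<le> n" by simp
  \<comment> \<open>As \<open>k \<le> n - 1\<close>, the quotient n!/k! is at least
    \<open>n\<close>.\<close>
  have "fact k * n \<le> (fact (n - 1) * n :: nat)"
    using assms by (intro mult_right_mono fact_mono_nat) auto
  also have "\<dots> = fact n"
    using assms by (simp add: fact_reduce [of n] mult.commute)
  finally have quotient_bound: "fact k * n \<le> (fact n :: nat)" .
  have "(fact k :: nat) dvd fact n"
    using assms by (intro fact_dvd) simp
  then obtain m :: nat where m: "fact n = m * fact k"
    by (metis dvd_def mult.commute)
  have "n \<le> m"
    using quotient_bound m by (simp add: mult.commute)
  with \<open>4 \<le> n\<close> have "4 \<le> m" by simp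
  moreover have "2 \<le> (fact k :: nat)"
    using fact_mono_nat [OF \<open>2 \<le> k\<close>] by simp
  ultimately have double: "2 * (fact n :: nat) ^ fact k \<le> fact k ^ fact n"
    using double_power_le_power_swap unfolding m by blast
  \<comment> \<open>The second copy of \<open>fact n ^ fact k\<close> absorbs \<open>n ^ k\<close>;
    strictness comes from \<open>k ^ n > 0\<close>.\<close>
  have "n ^ k \<le> (fact n :: nat) ^ k"
    by (intro power_mono fact_ge_self) simp
  also have "\<dots> \<le> fact n ^ fact k"
    by (intro power_increasing fact_ge_self fact_ge_1)
  finally have "n ^ k \<le> (fact n :: nat) ^ fact k" .
  moreover have "0 < k ^ n"
    using assms by simp
  ultimately show ?thesis
    using double by linarith
qed

text \<open>For \<open>k = 1\<close> the inequality reverses, 2 < n! + n, so only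
  \<open>\<noteq>\<close> holds uniformly.\<close>

lemma fact_power_swap_neq:
  fixes n k :: nat
  assumes "0 < k" "k < n"
  shows "(fact k :: nat) ^ fact n + k ^ n \<noteq> fact n ^ fact k + n ^ k"
proof (cases "k = 1")
  case True
  with assms have "n + fact n > 2"
    using fact_ge_1 [of n, where 'a = nat] by linarith
  with True show ?thesis by simp
next
  case False
  with assms fact_power_swap_less [of k n] show ?thesis by simp
qed

theorem theorem1p2:
  fixes n k :: nat
  assumes "n > 0" and "k > 0"
  shows "(fact k :: nat) ^ (fact n) + k ^ n = (fact n) ^ (fact k) + n ^ k \<longleftrightarrow> k = n"
  using fact_power_swap_neq [of k n] fact_power_swap_neq [of n k] assms
  by (cases k n rule: linorder_cases) auto

end
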